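(* Let $d$ be a metric on $\mathcal X$ such that $(\mathcal X,d)$ is a Polish space. Let $\mu\in\mathcal P(\mathcal X)$ be such that $\int_{\mathcal X}d(x_o,x)\,\mu(dx)<+\infty$ for all $x_o\in\mathcal X$, and suppose that $$\alpha(\mathcal T_d(\mu,\nu))\le H(\nu\mid\mu)\quad\forall\nu\in\mathcal P(\mathcal X)$$ holds with $\alpha\in\mathcal C$. Let $(X_i)$ be i.i.d. with law $\mu$. If $\mathcal G$ is a class of $1$-Lipschitz functions on $\mathcal X$, then the empirical process $$Z_n^{\mathcal G}:=\sup_{\varphi\in\mathcal G}\left|\frac1n\sum_{i=1}^n\varphi(X_i)-\int_{\mathcal X}\varphi\,d\mu\right|$$ satisfies $$\mathbb P\big(Z_n^{\mathcal G}\ge\mathbb E[Z_n^{\mathcal G}]+t\big)\le e^{-n\alpha(t)}\quad\forall t\ge0.$$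
   Context: $\mathcal P(\mathcal X)$ is the set of Borel probability measures on $\mathcal X$. Lipschitz is with respect to $d$. $\mathcal T_d(\mu,\nu)=\inf_\pi\int d(x,y)\,\pi(dx\,dy)\in[0,\infty]$, the infimum over all probability measures $\pi$ on $\mathcal X\times\mathcal X$ with first marginal $\mu$ and second marginal $\nu$. $H(\nu\mid\mu)=\int\log\frac{d\nu}{d\mu}\,d\nu$ if $\nu\ll\mu$ and $+\infty$ otherwise. $\mathcal C$ is the class of all functions $\alpha$ on $[0,\infty)$ with values in $[0,\infty]$ that are convex, increasing (meaning nondecreasing), left continuous, with $\alpha(0)=0$; one sets $\alpha(+\infty)=\lim_{t\to\infty}\alpha(t)$. *)

theory Defs
  imports "HOL-Probability.Probability"
begin

definition borel_probs :: "'a::topological_space measure set" where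
  "borel_probs = {\<mu>. prob_space \<mu> \<and> sets \<mu> = sets borel}"

(* On a second countable space the product of the Borel sigma-algebras is the Borel
   sigma-algebra of the product space (borel_prod). *)
definition couplings ::
  "'a::second_countable_topology measure \<Rightarrow> 'a measure \<Rightarrow> ('a \<times> 'a) measure set" where
  "couplings \<mu> \<nu> =
     {\<pi>. \<pi> \<in> borel_probs \<and> distr \<pi> borel fst = \<mu> \<and> distr \<pi> borel snd = \<nu>}"

definition transport_cost ::
  "'a::{metric_space, second_countable_topology} measure \<Rightarrow> 'a measure \<Rightarrow> ennreal" where
  "transport_cost \<mu> \<nu> = (INF \<pi>\<in>couplings \<mu> \<nu>. \<integral>\<^sup>+p. ennreal (dist (fst p) (snd p)) \<partial>\<pi>)"

(* The integral of log (d nu / d mu) with respect to nu may be +infinity, so it is written as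
   integral of the positive part minus integral of the negative part; the latter is always finite.
   The values of the density 0 (where ln 0 = 0 by convention) and infinity only occur on
   nu-null sets. *)
definition rel_entropy :: "'a measure \<Rightarrow> 'a measure \<Rightarrow> ereal" where
  "rel_entropy \<nu> \<mu> =
     (if absolutely_continuous \<mu> \<nu>
      then enn2ereal (\<integral>\<^sup>+x. ennreal (ln (enn2real (RN_deriv \<mu> \<nu> x))) \<partial>\<nu>)
         - enn2ereal (\<integral>\<^sup>+x. ennreal (- ln (enn2real (RN_deriv \<mu> \<nu> x))) \<partial>\<nu>)
      else \<infinity>)"

(* The class of admissible functions on [0,infinity); values at negative arguments are
   irrelevant. Convexity is spelled out because ennreal is not a real vector space
   (note 0 * infinity = 0 in ennreal). *)
definition alpha_class :: "(real \<Rightarrow> ennreal) set" where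
  "alpha_class = {\<alpha>.
     (\<forall>s\<ge>0. \<forall>t\<ge>0. \<forall>u\<in>{0..1}.
        \<alpha> ((1 - u) * s + u * t) \<le> ennreal (1 - u) * \<alpha> s + ennreal u * \<alpha> t) \<and>
     mono_on {0..} \<alpha> \<and>
     (\<forall>t>0. (\<alpha> \<longlongrightarrow> \<alpha> t) (at_left t)) \<and>
     \<alpha> 0 = 0}"

definition alpha_ext :: "(real \<Rightarrow> ennreal) \<Rightarrow> ennreal \<Rightarrow> ennreal" where
  "alpha_ext \<alpha> x = (if x = \<infinity> then Lim at_top \<alpha> else \<alpha> (enn2real x))"

definition exp_minus :: "ennreal \<Rightarrow> real" where
  "exp_minus x = (if x = \<infinity> then 0 else exp (- enn2real x))"

(* The supremum is taken in [0,infinity], so no boundedness of the family is presupposed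
   and the empty class gives 0. *)
definition emp_process ::
  "'a measure \<Rightarrow> ('a \<Rightarrow> real) set \<Rightarrow> (nat \<Rightarrow> 'w \<Rightarrow> 'a) \<Rightarrow> nat \<Rightarrow> 'w \<Rightarrow> ennreal" where
  "emp_process \<mu> \<G> X n \<omega> =
     (SUP \<phi>\<in>\<G>. ennreal \<bar>(1 / real n) * (\<Sum>i=1..n. \<phi> (X i \<omega>)) - (\<integral>x. \<phi> x \<partial>\<mu>)\<bar>)"

end

theory Submission
  imports Defs
begin

text \<open>
  The transport inequality is equivalent to an exponential moment bound, and exponential moment
  bounds tensorize; this is the whole proof.

  One direction of that equivalence suffices, and it is elementary. Tilt \<open>\<mu>\<close> by
  \<open>exp (s * \<phi>)\<close>, where \<open>\<phi>\<close> is bounded and 1-Lipschitz, and call the resulting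
  probability measure \<open>\<nu>\<close>. By the Gibbs identity (\<open>rel_entropy_gibbs\<close>) the logarithm
  of \<open>\<integral> exp (s * \<phi>) \<partial>\<mu>\<close> is \<open>s * \<integral> \<phi> \<partial>\<nu>\<close> minus the entropy of \<open>\<nu>\<close>. A 1-Lipschitz
  function cannot have means under \<open>\<mu>\<close> and \<open>\<nu>\<close> that differ by more than the
  transport cost \<open>T\<close> (\<open>transport_cost_ge\<close>), and the entropy is at least \<open>\<alpha> T\<close> by
  hypothesis. Hence the logarithm of \<open>\<integral> exp (s * (\<phi> - \<integral> \<phi> \<partial>\<mu>)) \<partial>\<mu>\<close> is at
  most \<open>s * w - \<alpha> w\<close> for some \<open>w \<ge> 0\<close>, and therefore at most every \<open>A\<close> such that the line
  \<open>u \<mapsto> s * u - A\<close> lies below \<open>\<alpha>\<close> on the half-line. Truncation and Fatou's lemma remove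
  the boundedness of \<open>\<phi>\<close> (\<open>laplace_lipschitz\<close>).

  Consider now the sum metric on \<open>n\<close>-tuples. A function \<open>H\<close> that is 1-Lipschitz for it is
  1-Lipschitz in each coordinate, and integrating one coordinate out leaves a function of the
  same kind in the others. Integrating the coordinates one at a time, each at the cost of a factor
  \<open>exp A\<close>, bounds \<open>\<integral> exp (s * (H - \<integral> H))\<close> by \<open>exp (n * A)\<close> (\<open>laplace_tensorize\<close>).
  The empirical process multiplied by \<open>n\<close> is such a function, because a supremum of 1-Lipschitz
  functions is 1-Lipschitz; its continuity also settles measurability, which is not evident
  for an uncountable supremum.

  The Chernoff bound now gives the deviation probability \<open>exp (- n * (s * t - A))\<close> for every line
  \<open>u \<mapsto> s * u - A\<close> below \<open>\<alpha>\<close>. Since \<open>\<alpha>\<close> is convex, nondecreasing and left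
  continuous, it is the supremum of these lines (\<open>alpha_supporting_line\<close>), and
  the best choice of the line turns the exponent into \<open>- n * \<alpha> t\<close>.
\<close>

section \<open>Lipschitz functions and transport cost\<close>

lemma borel_probsD:
  assumes "\<mu> \<in> borel_probs"
  shows "prob_space \<mu>" "sets \<mu> = sets borel" "space \<mu> = UNIV"
  using assms sets_eq_imp_space_eq[of \<mu> borel] by (auto simp: borel_probs_def)

lemma lipschitz_measurable:
  fixes \<phi> :: "'a::metric_space \<Rightarrow> real"
  assumes "L-lipschitz_on UNIV \<phi>" and "sets \<mu> = sets borel"
  shows "\<phi> \<in> borel_measurable \<mu>"
proof -
  have "\<phi> \<in> borel_measurable borel"
    by (intro borel_measurable_continuous_onI lipschitz_on_continuous_on[OF assms(1)])
  then show ?thesis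
    using measurable_cong_sets[OF assms(2) refl] by blast
qed

lemma dist_lipschitz: "1-lipschitz_on UNIV (\<lambda>x. dist c x)"
proof (rule lipschitz_onI)
  show "dist (dist c x) (dist c y) \<le> 1 * dist x y" for x y
    using dist_triangle[of c x y] dist_triangle[of c y x]
    by (auto simp: dist_real_def dist_commute)
qed simp

lemma lipschitz_integrable:
  fixes \<phi> :: "'a::{metric_space, second_countable_topology} \<Rightarrow> real"
  assumes "\<mu> \<in> borel_probs" and "(\<integral>\<^sup>+x. ennreal (dist c x) \<partial>\<mu>) < \<infinity>"
    and "1-lipschitz_on UNIV \<phi>"
  shows "integrable \<mu> \<phi>"
proof -
  interpret prob_space \<mu> using assms(1) by (rule borel_probsD)
  have sets: "sets \<mu> = sets borel" using assms(1) by (rule borel_probsD)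
  have d: "(\<lambda>x. dist c x) \<in> borel_measurable \<mu>"
    using dist_lipschitz sets by (rule lipschitz_measurable)
  have "integrable \<mu> (\<lambda>x. dist c x)"
    using assms(2) d by (intro integrableI_bounded) auto
  then have "integrable \<mu> (\<lambda>x. \<bar>\<phi> c\<bar> + dist c x)"
    by auto
  then show ?thesis
  proof (rule Bochner_Integration.integrable_bound)
    show "\<phi> \<in> borel_measurable \<mu>"
      using assms(3) sets by (rule lipschitz_measurable)
    have "\<bar>\<phi> x\<bar> \<le> \<bar>\<phi> c\<bar> + dist c x" for x
      using lipschitz_onD[OF assms(3), of c x] by (auto simp: dist_real_def)
    then show "AE x in \<mu>. norm (\<phi> x) \<le> norm (\<bar>\<phi> c\<bar> + dist c x)"
      by (auto intro!: AE_I2 order_trans[OF _ abs_ge_self])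
  qed
qed

text \<open>
  This is the easy half of Kantorovich duality: under any coupling the difference of the means is
  the integral of \<open>\<phi> y - \<phi> x\<close>, and this integrand is dominated by \<open>dist x y\<close>. Boundedness
  serves to make both means finite for an arbitrary \<open>\<nu>\<close>.
\<close>
lemma transport_cost_ge:
  fixes \<phi> :: "'a::{metric_space, second_countable_topology} \<Rightarrow> real"
  assumes "1-lipschitz_on UNIV \<phi>" and B: "\<And>x. \<bar>\<phi> x\<bar> \<le> B"
  shows "ennreal ((\<integral>x. \<phi> x \<partial>\<nu>) - (\<integral>x. \<phi> x \<partial>\<mu>)) \<le> transport_cost \<mu> \<nu>"
  unfolding transport_cost_def
proof (rule INF_greatest)
  fix \<pi> assume "\<pi> \<in> couplings \<mu> \<nu>"
  then have \<pi>: "\<pi> \<in> borel_probs" and \<mu>: "\<mu> = distr \<pi> borel fst" and \<nu>: "\<nu> = distr \<pi> borel snd"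
    by (auto simp: couplings_def)
  interpret prob_space \<pi> using \<pi> by (rule borel_probsD)
  have sets: "sets \<pi> = sets borel" using \<pi> by (rule borel_probsD)
  have [measurable]: "fst \<in> measurable \<pi> borel" "snd \<in> measurable \<pi> borel"
    unfolding measurable_cong_sets[OF sets refl]
    by (intro borel_measurable_continuous_onI continuous_intros)+
  have [measurable]: "\<phi> \<in> borel_measurable borel"
    using assms(1) by (rule lipschitz_measurable) simp
  have int: "integrable \<pi> (\<lambda>p. \<phi> (fst p))" "integrable \<pi> (\<lambda>p. \<phi> (snd p))"
    using B by (auto intro!: integrable_const_bound[where B=B])
  have "(\<integral>x. \<phi> x \<partial>\<nu>) - (\<integral>x. \<phi> x \<partial>\<mu>) = (\<integral>p. \<phi> (snd p) - \<phi> (fst p) \<partial>\<pi>)"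
    unfolding \<mu> \<nu> using int by (simp add: integral_distr)
  then have "ennreal ((\<integral>x. \<phi> x \<partial>\<nu>) - (\<integral>x. \<phi> x \<partial>\<mu>)) \<le> ennreal (norm (\<integral>p. \<phi> (snd p) - \<phi> (fst p) \<partial>\<pi>))"
    by (intro ennreal_leI) auto
  also have "\<dots> \<le> (\<integral>\<^sup>+p. norm (\<phi> (snd p) - \<phi> (fst p)) \<partial>\<pi>)"
    using int by (intro integral_norm_bound_ennreal) auto
  also have "\<dots> \<le> (\<integral>\<^sup>+p. ennreal (dist (fst p) (snd p)) \<partial>\<pi>)"
    using lipschitz_onD[OF assms(1)]
    by (intro nn_integral_mono ennreal_leI) (auto simp: dist_real_def abs_minus_commute)
  finally show "ennreal ((\<integral>x. \<phi> x \<partial>\<nu>) - (\<integral>x. \<phi> x \<partial>\<mu>)) \<le> (\<integral>\<^sup>+p. ennreal (dist (fst p) (snd p)) \<partial>\<pi>)" .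
qed

section \<open>Entropy and exponential moments\<close>

text \<open>
  The density of the tilted measure is \<open>exp g / c\<close>, so its logarithm is \<open>g - ln c\<close>. For bounded
  \<open>g\<close> this is integrable, and the difference of two nonnegative integrals that defines the entropy
  collapses to an ordinary integral.
\<close>
lemma rel_entropy_gibbs:
  fixes g :: "'a \<Rightarrow> real"
  assumes "prob_space \<mu>" and g[measurable]: "g \<in> borel_measurable \<mu>" and B: "\<And>x. \<bar>g x\<bar> \<le> B"
  defines "c \<equiv> \<integral>x. exp (g x) \<partial>\<mu>"
  defines "\<nu> \<equiv> density \<mu> (\<lambda>x. ennreal (exp (g x) / c))"
  shows "c > 0" "prob_space \<nu>" "rel_entropy \<nu> \<mu> = ereal ((\<integral>x. g x \<partial>\<nu>) - ln c)"
proof -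
  interpret prob_space \<mu> by fact
  have int: "integrable \<mu> (\<lambda>x. exp (g x))"
    using B by (intro integrable_const_bound[where B="exp B"]) (auto simp: abs_le_iff)
  have "exp (- B) = (\<integral>x. exp (- B) \<partial>\<mu>)"
    by (simp add: prob_space)
  also have "\<dots> \<le> c"
    unfolding c_def using B int
    by (intro integral_mono) (auto simp: abs_le_iff minus_le_iff)
  finally have "exp (- B) \<le> c" .
  then show c: "c > 0" by (rule less_le_trans[rotated]) simp
  have "emeasure \<nu> (space \<nu>) = (\<integral>\<^sup>+x. ennreal (exp (g x) / c) \<partial>\<mu>)"
    unfolding \<nu>_def by (simp add: emeasure_density nn_integral_set_ennreal[symmetric] cong: nn_integral_cong)
  also have "\<dots> = ennreal (\<integral>x. exp (g x) / c \<partial>\<mu>)"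
    using int c by (intro nn_integral_eq_integral) auto
  also have "\<dots> = 1"
    using c by (simp add: c_def)
  finally show \<nu>: "prob_space \<nu>" by (rule prob_spaceI)
  interpret \<nu>: prob_space \<nu> by fact
  have [measurable]: "g \<in> borel_measurable \<nu>" unfolding \<nu>_def by simp
  have ac: "absolutely_continuous \<mu> \<nu>"
    unfolding \<nu>_def by (rule absolutely_continuousI_density) simp
  have "AE x in \<mu>. ennreal (exp (g x) / c) = RN_deriv \<mu> \<nu> x"
    by (rule RN_deriv_unique) (simp_all add: \<nu>_def)
  then have "AE x in \<nu>. ennreal (exp (g x) / c) = RN_deriv \<mu> \<nu> x"
    unfolding \<nu>_def by (subst AE_density) auto
  then have ln: "AE x in \<nu>. ln (enn2real (RN_deriv \<mu> \<nu> x)) = g x - ln c"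
  proof eventually_elim
    case (elim x)
    then show ?case using c by (simp flip: elim add: ln_div)
  qed
  have intg: "integrable \<nu> g"
    using B by (intro \<nu>.integrable_const_bound[where B=B]) auto
  then have int': "integrable \<nu> (\<lambda>x. g x - ln c)" by simp
  have 1: "(\<integral>\<^sup>+x. ennreal (ln (enn2real (RN_deriv \<mu> \<nu> x))) \<partial>\<nu>) = (\<integral>\<^sup>+x. ennreal (g x - ln c) \<partial>\<nu>)"
    using ln by (intro nn_integral_cong_AE) auto
  have 2: "(\<integral>\<^sup>+x. ennreal (- ln (enn2real (RN_deriv \<mu> \<nu> x))) \<partial>\<nu>) = (\<integral>\<^sup>+x. ennreal (- (g x - ln c)) \<partial>\<nu>)"
    using ln by (intro nn_integral_cong_AE) auto
  have fin: "(\<integral>\<^sup>+x. ennreal (g x - ln c) \<partial>\<nu>) < \<infinity>" "(\<integral>\<^sup>+x. ennreal (- (g x - ln c)) \<partial>\<nu>) < \<infinity>"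
    using int' unfolding real_integrable_def by (auto simp: less_top)
  have "ereal (\<integral>x. g x - ln c \<partial>\<nu>) =
      enn2ereal (\<integral>\<^sup>+x. ennreal (g x - ln c) \<partial>\<nu>) - enn2ereal (\<integral>\<^sup>+x. ennreal (- (g x - ln c)) \<partial>\<nu>)"
    unfolding real_lebesgue_integral_def[OF int'] using fin
    by (cases "\<integral>\<^sup>+x. ennreal (g x - ln c) \<partial>\<nu>"; cases "\<integral>\<^sup>+x. ennreal (- (g x - ln c)) \<partial>\<nu>")
       (auto simp: enn2ereal_ennreal)
  then show "rel_entropy \<nu> \<mu> = ereal ((\<integral>x. g x \<partial>\<nu>) - ln c)"
    unfolding rel_entropy_def 1 2 using ac intg by (simp add: \<nu>.prob_space)
qed

lemma alpha_mono:
  assumes "\<alpha> \<in> alpha_class" "0 \<le> s" "s \<le> t"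
  shows "\<alpha> s \<le> \<alpha> t"
  using assms by (auto simp: alpha_class_def mono_on_def)

text \<open>
  A lower bound on the transport cost thus becomes a lower bound on the entropy, even if the cost
  is infinite: by monotonicity the limit of \<open>\<alpha>\<close> at infinity is its supremum.
\<close>
lemma alpha_ext_ge:
  assumes \<alpha>: "\<alpha> \<in> alpha_class" and w: "0 \<le> w" "ennreal w \<le> T"
  shows "\<alpha> w \<le> alpha_ext \<alpha> T"
proof (cases "T = \<infinity>")
  case True
  have up: "\<alpha> t \<le> (SUP t\<in>{0..}. \<alpha> t)" if "t \<ge> 0" for t
    using that by (intro SUP_upper) auto
  have "(\<alpha> \<longlongrightarrow> (SUP t\<in>{0..}. \<alpha> t)) at_top"
  proof (rule increasing_tendsto)
    show "\<forall>\<^sub>F t in at_top. \<alpha> t \<le> (SUP t\<in>{0..}. \<alpha> t)"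
      using eventually_ge_at_top[of 0] by eventually_elim (rule up)
  next
    fix x assume "x < (SUP t\<in>{0..}. \<alpha> t)"
    then obtain u where u: "u \<ge> 0" "x < \<alpha> u"
      by (auto simp: less_SUP_iff)
    show "\<forall>\<^sub>F t in at_top. x < \<alpha> t"
      using eventually_ge_at_top[of u]
    proof eventually_elim
      case (elim t)
      then show ?case using alpha_mono[OF \<alpha> u(1) elim] u(2) by simp
    qed
  qed
  then have "Lim at_top \<alpha> = (SUP t\<in>{0..}. \<alpha> t)"
    by (intro tendsto_Lim) auto
  then show ?thesis using up[OF w(1)] True by (simp add: alpha_ext_def)
next
  case False
  then obtain r where "r \<ge> 0" "T = ennreal r" by (cases T) auto
  then show ?thesis using w alpha_mono[OF \<alpha>, of w r] by (simp add: alpha_ext_def)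
qed

text \<open>
  Here \<open>A\<close> is any upper bound on the Legendre transform of \<open>\<alpha>\<close> at \<open>s\<close>. Quantifying over
  lines below \<open>\<alpha>\<close> in place of the transform itself avoids infinite values.
\<close>
lemma laplace_bounded_lipschitz:
  fixes \<mu> :: "'a::{metric_space, second_countable_topology} measure"
  assumes \<mu>: "\<mu> \<in> borel_probs" and \<alpha>: "\<alpha> \<in> alpha_class"
    and tci: "\<And>\<nu>. \<nu> \<in> borel_probs \<Longrightarrow>
           enn2ereal (alpha_ext \<alpha> (transport_cost \<mu> \<nu>)) \<le> rel_entropy \<nu> \<mu>"
    and s: "s \<ge> 0" and line: "\<And>u. u \<ge> 0 \<Longrightarrow> ennreal (s * u - A) \<le> \<alpha> u" and A: "A \<ge> 0"
    and \<phi>: "1-lipschitz_on UNIV \<phi>" and B: "\<And>x. \<bar>\<phi> x\<bar> \<le> B"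
  shows "(\<integral>\<^sup>+x. ennreal (exp (s * \<phi> x)) \<partial>\<mu>) \<le> ennreal (exp (s * (\<integral>x. \<phi> x \<partial>\<mu>) + A))"
proof -
  interpret prob_space \<mu> using \<mu> by (rule borel_probsD)
  have [measurable]: "\<phi> \<in> borel_measurable \<mu>"
    using \<phi> borel_probsD(2)[OF \<mu>] by (rule lipschitz_measurable)
  define c where "c = (\<integral>x. exp (s * \<phi> x) \<partial>\<mu>)"
  define \<nu> where "\<nu> = density \<mu> (\<lambda>x. ennreal (exp (s * \<phi> x) / c))"
  have B': "\<bar>s * \<phi> x\<bar> \<le> s * B" for x
    using s B by (simp add: abs_mult mult_left_mono)
  have c: "c > 0" and \<nu>: "prob_space \<nu>" and ent: "rel_entropy \<nu> \<mu> = ereal ((\<integral>x. s * \<phi> x \<partial>\<nu>) - ln c)"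
    using rel_entropy_gibbs[OF prob_space_axioms _ B'] unfolding c_def \<nu>_def by simp_all
  have \<nu>': "\<nu> \<in> borel_probs"
    using \<nu> borel_probsD(2)[OF \<mu>] by (simp add: borel_probs_def \<nu>_def)
  \<comment> \<open>If the tilt lowers the mean of \<open>\<phi>\<close>, the estimate below only needs \<open>\<alpha>\<close> at 0.\<close>
  define w where "w = max 0 ((\<integral>x. \<phi> x \<partial>\<nu>) - (\<integral>x. \<phi> x \<partial>\<mu>))"
  have "ennreal w \<le> transport_cost \<mu> \<nu>"
    using transport_cost_ge[OF \<phi> B, of \<nu> \<mu>] by (auto simp: w_def max_def ennreal_neg)
  then have "\<alpha> w \<le> alpha_ext \<alpha> (transport_cost \<mu> \<nu>)"
    using \<alpha> by (intro alpha_ext_ge) (auto simp: w_def)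
  then have "ennreal (s * w - A) \<le> alpha_ext \<alpha> (transport_cost \<mu> \<nu>)"
    using line[of w] by (auto simp: w_def intro: order_trans)
  then have "enn2ereal (ennreal (s * w - A)) \<le> rel_entropy \<nu> \<mu>"
    using tci[OF \<nu>'] by (auto simp: less_eq_ennreal.rep_eq intro: order_trans)
  moreover have "ereal (s * w - A) \<le> enn2ereal (ennreal (s * w - A))"
    by (cases "s * w - A \<ge> 0") (auto simp: enn2ereal_ennreal ennreal_neg zero_ennreal.rep_eq)
  ultimately have "ereal (s * w - A) \<le> ereal ((\<integral>x. s * \<phi> x \<partial>\<nu>) - ln c)"
    unfolding ent by (rule order_trans[rotated])
  then have "s * w - A \<le> s * (\<integral>x. \<phi> x \<partial>\<nu>) - ln c"
    by simp
  moreover have "s * ((\<integral>x. \<phi> x \<partial>\<nu>) - (\<integral>x. \<phi> x \<partial>\<mu>)) \<le> s * w"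
    using s by (intro mult_left_mono) (auto simp: w_def)
  ultimately have "ln c \<le> s * (\<integral>x. \<phi> x \<partial>\<mu>) + A"
    by (simp add: algebra_simps)
  then have "c \<le> exp (s * (\<integral>x. \<phi> x \<partial>\<mu>) + A)"
    using c by (metis exp_ln exp_le_cancel_iff)
  moreover have "integrable \<mu> (\<lambda>x. exp (s * \<phi> x))"
    using B' by (intro integrable_const_bound[where B="exp (s * B)"]) (auto simp: abs_le_iff)
  then have "(\<integral>\<^sup>+x. ennreal (exp (s * \<phi> x)) \<partial>\<mu>) = ennreal c"
    unfolding c_def by (intro nn_integral_eq_integral) auto
  ultimately show ?thesis by (simp add: ennreal_leI)
qed

text \<open>
  Clipping a 1-Lipschitz function keeps it 1-Lipschitz, so the bounded case applies to
  all clipped functions. The means converge by dominated convergence, and the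
  exponential moments pass to the limit by Fatou's lemma, which presupposes no
  exponential integrability of \<open>\<phi>\<close>.
\<close>
lemma laplace_lipschitz:
  fixes \<mu> :: "'a::{metric_space, second_countable_topology} measure"
  assumes \<mu>: "\<mu> \<in> borel_probs" and moment: "(\<integral>\<^sup>+x. ennreal (dist x\<^sub>o x) \<partial>\<mu>) < \<infinity>"
    and \<alpha>: "\<alpha> \<in> alpha_class"
    and tci: "\<And>\<nu>. \<nu> \<in> borel_probs \<Longrightarrow>
           enn2ereal (alpha_ext \<alpha> (transport_cost \<mu> \<nu>)) \<le> rel_entropy \<nu> \<mu>"
    and s: "s \<ge> 0" and line: "\<And>u. u \<ge> 0 \<Longrightarrow> ennreal (s * u - A) \<le> \<alpha> u" and A: "A \<ge> 0"
    and \<phi>: "1-lipschitz_on UNIV \<phi>"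
  shows "(\<integral>\<^sup>+x. ennreal (exp (s * \<phi> x)) \<partial>\<mu>) \<le> ennreal (exp (s * (\<integral>x. \<phi> x \<partial>\<mu>) + A))"
proof -
  define \<psi> where "\<psi> k x = max (- real k) (min (real k) (\<phi> x))" for k x
  have sets: "sets \<mu> = sets borel" using \<mu> by (rule borel_probsD)
  have int: "integrable \<mu> \<phi>"
    using \<mu> moment \<phi> by (rule lipschitz_integrable)
  have lip: "1-lipschitz_on UNIV (\<psi> k)" for k
  proof (rule lipschitz_onI)
    fix x y :: 'a
    show "dist (\<psi> k x) (\<psi> k y) \<le> 1 * dist x y"
      using lipschitz_onD[OF \<phi>, of x y] by (auto simp: \<psi>_def dist_real_def max_def min_def)
  qed simp
  have meas [measurable]: "\<psi> k \<in> borel_measurable \<mu>" for k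
    using lip sets by (rule lipschitz_measurable)
  have lim: "(\<lambda>k. \<psi> k x) \<longlonglongrightarrow> \<phi> x" for x
  proof -
    obtain N where "\<bar>\<phi> x\<bar> \<le> real N" using real_arch_simple by blast
    then have "\<psi> k x = \<phi> x" if "k \<ge> N" for k
      using of_nat_mono[OF that, where 'a=real] by (auto simp: \<psi>_def max_def min_def)
    then show ?thesis
      by (intro tendsto_eventually) (auto simp: eventually_sequentially)
  qed
  have lim_int: "(\<lambda>k. \<integral>x. \<psi> k x \<partial>\<mu>) \<longlonglongrightarrow> (\<integral>x. \<phi> x \<partial>\<mu>)"
  proof (rule integral_dominated_convergence[where w="\<lambda>x. \<bar>\<phi> x\<bar>"])
    show "AE x in \<mu>. norm (\<psi> k x) \<le> \<bar>\<phi> x\<bar>" for k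
      by (auto simp: \<psi>_def)
  qed (use int lim in auto)
  have bd: "(\<integral>\<^sup>+x. ennreal (exp (s * \<psi> k x)) \<partial>\<mu>) \<le> ennreal (exp (s * (\<integral>x. \<psi> k x \<partial>\<mu>) + A))" for k
    by (rule laplace_bounded_lipschitz[OF \<mu> \<alpha> tci s line A lip, where B="real k"])
       (auto simp: \<psi>_def)
  have "(\<integral>\<^sup>+x. ennreal (exp (s * \<phi> x)) \<partial>\<mu>) = (\<integral>\<^sup>+x. liminf (\<lambda>k. ennreal (exp (s * \<psi> k x))) \<partial>\<mu>)"
    by (intro nn_integral_cong lim_imp_Liminf[symmetric] tendsto_ennrealI tendsto_intros lim) auto
  also have "\<dots> \<le> liminf (\<lambda>k. \<integral>\<^sup>+x. ennreal (exp (s * \<psi> k x)) \<partial>\<mu>)"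
    by (intro nn_integral_liminf) measurable
  also have "\<dots> \<le> liminf (\<lambda>k. ennreal (exp (s * (\<integral>x. \<psi> k x \<partial>\<mu>) + A)))"
    using bd by (intro Liminf_mono always_eventually) auto
  also have "\<dots> = ennreal (exp (s * (\<integral>x. \<phi> x \<partial>\<mu>) + A))"
    by (intro lim_imp_Liminf tendsto_ennrealI tendsto_intros lim_int) auto
  finally show ?thesis .
qed

section \<open>Supporting lines of a convex function\<close>

text \<open>
  This is biconjugation in the form needed for the Chernoff bound: \<open>\<alpha>\<close> is the supremum of the
  lines below it that have nonnegative slope. At a point \<open>t\<close> where \<open>\<alpha>\<close> is infinite, or at an
  end point of its domain, there need not be a supporting line. If \<open>\<alpha>\<close> is infinite already at
  some \<open>v < t\<close>, a steep line through \<open>(v, 0)\<close> does the job. Otherwise left continuity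
  allows moving to a point \<open>x < t\<close> in the interior of the domain where \<open>\<alpha>\<close> still exceeds
  \<open>r\<close>; a supporting line at \<open>x\<close> exists, and it can only grow from \<open>x\<close> to \<open>t\<close>.
\<close>
lemma alpha_supporting_line:
  assumes \<alpha>: "\<alpha> \<in> alpha_class" and t: "t > 0" and r: "r \<ge> 0" "ennreal r < \<alpha> t"
  obtains s A where "s \<ge> 0" "A \<ge> 0" "\<And>u. u \<ge> 0 \<Longrightarrow> ennreal (s * u - A) \<le> \<alpha> u" "s * t - A \<ge> r"
proof (cases "\<exists>u\<in>{0..<t}. \<alpha> u = \<infinity>")
  case True
  then obtain v where v: "0 \<le> v" "v < t" "\<alpha> v = \<infinity>" by auto
  \<comment> \<open>The line through \<open>(v, 0)\<close> and \<open>(t, r)\<close>.\<close>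
  define s where "s = r / (t - v)"
  have s: "s \<ge> 0" "s * t - s * v = r"
    using v r by (auto simp: s_def simp flip: diff_divide_distrib right_diff_distrib)
  have "ennreal (s * u - s * v) \<le> \<alpha> u" if "u \<ge> 0" for u
  proof (cases "u \<le> v")
    case True
    then have "s * u - s * v \<le> 0" using s(1) by (simp add: mult_left_mono)
    then show ?thesis by (simp add: ennreal_neg)
  next
    case False
    then have "\<alpha> v \<le> \<alpha> u" using v by (intro alpha_mono[OF \<alpha>]) auto
    then show ?thesis using v by (simp add: top_unique)
  qed
  with that[of s "s * v"] s v show ?thesis by auto
next
  case False
  have cvx: "\<alpha> ((1 - l) * u + l * v) \<le> ennreal (1 - l) * \<alpha> u + ennreal l * \<alpha> v"
    if "0 \<le> u" "0 \<le> v" "0 \<le> l" "l \<le> 1" for u v l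
    using \<alpha> that by (auto simp: alpha_class_def)
  have "(\<alpha> \<longlongrightarrow> \<alpha> t) (at_left t)" using \<alpha> t by (auto simp: alpha_class_def)
  then have "\<forall>\<^sub>F x in at_left t. ennreal r < \<alpha> x"
    using r(2) by (rule order_tendstoD)
  moreover have "\<forall>\<^sub>F x in at_left t. x \<in> {0<..<t}"
    using t by (rule eventually_at_left_real)
  ultimately have "\<forall>\<^sub>F x in at_left t. x \<in> {0<..<t} \<and> ennreal r < \<alpha> x"
    by eventually_elim auto
  then obtain x where x: "0 < x" "x < t" "ennreal r < \<alpha> x"
    using eventually_happens'[OF trivial_limit_at_left_real] by force
  define I where "I = {u. u \<ge> 0 \<and> \<alpha> u < \<infinity>}"
  define f where "f u = enn2real (\<alpha> u)" for u
  have f: "\<alpha> u = ennreal (f u)" "f u \<ge> 0" if "u \<in> I" for u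
    using that by (auto simp: f_def I_def)
  have comb: "(1 - l) * u + l * v \<in> I \<and> f ((1 - l) * u + l * v) \<le> (1 - l) * f u + l * f v"
    if "u \<in> I" "v \<in> I" "0 \<le> l" "l \<le> 1" for u v l
  proof -
    have nn: "u \<ge> 0" "v \<ge> 0" using that by (auto simp: I_def)
    have "\<alpha> ((1 - l) * u + l * v) \<le> ennreal (1 - l) * \<alpha> u + ennreal l * \<alpha> v"
      by (rule cvx[OF nn that(3,4)])
    also have "\<dots> = ennreal ((1 - l) * f u + l * f v)"
      using f[OF that(1)] f[OF that(2)] that(3,4) by (simp add: ennreal_mult ennreal_plus)
    finally have *: "\<alpha> ((1 - l) * u + l * v) \<le> ennreal ((1 - l) * f u + l * f v)" .
    then have "(1 - l) * u + l * v \<in> I"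
      using nn that(3,4) by (auto simp: I_def intro: le_less_trans)
    moreover have "0 \<le> (1 - l) * f u + l * f v"
      using f(2)[OF that(1)] f(2)[OF that(2)] that(3,4) by simp
    ultimately show ?thesis using * f(1)[of "(1 - l) * u + l * v"] by (simp add: ennreal_le_iff)
  qed
  have "convex_on I f"
  proof (rule convex_onI)
    show "f ((1 - l) *\<^sub>R u + l *\<^sub>R v) \<le> (1 - l) * f u + l * f v"
      if "0 < l" "l < 1" "u \<in> I" "v \<in> I" for l u v
      using comb[of u v l] that by auto
    show "convex I"
      unfolding convex_alt using comb by auto
  qed
  have sub: "{0<..<t} \<subseteq> I" using False by (auto simp: I_def less_top)
  then have "x \<in> interior I"
    using x by (intro interiorI[of "{0<..<t}"]) auto
  \<comment> \<open>The right derivative of \<open>f\<close> at \<open>x\<close>.\<close>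
  define s where "s = Inf ((\<lambda>u. (f x - f u) / (x - u)) ` ({x<..} \<inter> I))"
  have line: "f u \<ge> f x + s * (u - x)" if "u \<in> I" for u
    unfolding s_def by (rule convex_le_Inf_differential) fact+
  have xI: "x \<in> I" using sub x by auto
  have "s \<ge> 0"
    unfolding s_def
  proof (rule cInf_greatest)
    have "(x + t) / 2 \<in> {x<..} \<inter> I" using x sub by auto
    then show "(\<lambda>u. (f x - f u) / (x - u)) ` ({x<..} \<inter> I) \<noteq> {}" by blast
    fix y assume "y \<in> (\<lambda>u. (f x - f u) / (x - u)) ` ({x<..} \<inter> I)"
    then obtain u where u: "u > x" "u \<in> I" "y = (f x - f u) / (x - u)" by auto
    have "f x \<le> f u"
      using alpha_mono[OF \<alpha>, of x u] x u f(1)[OF xI] f[OF u(2)] by (simp add: ennreal_le_iff)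
    with u show "0 \<le> y" by (simp add: divide_nonpos_nonpos)
  qed
  moreover have "s * x - f x \<ge> 0"
  proof -
    have "0 \<in> I" "f 0 = 0" using \<alpha> by (auto simp: I_def f_def alpha_class_def)
    with line[of 0] show ?thesis by simp
  qed
  moreover have "ennreal (s * u - (s * x - f x)) \<le> \<alpha> u" if "u \<ge> 0" for u
  proof (cases "u \<in> I")
    case True
    then show ?thesis using line[OF True] f(1)[OF True] by (simp add: ennreal_leI algebra_simps)
  next
    case False
    then show ?thesis using that by (simp add: I_def less_top[symmetric])
  qed
  moreover have "s * t - (s * x - f x) \<ge> r"
  proof -
    have "r < f x" using x(3) r(1) f[OF xI] by (simp add: ennreal_less_iff)
    moreover have "s * x \<le> s * t" using \<open>s \<ge> 0\<close> x by (simp add: mult_left_mono)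
    ultimately show ?thesis by simp
  qed
  ultimately show ?thesis by (rule that)
qed

section \<open>Tensorization\<close>

text \<open>
  The hypothesis makes \<open>H\<close> continuous for the product topology on the full function space, whose
  Borel sets are the product sigma-algebra since the space is second countable. It also shows
  that \<open>H\<close> depends only on the coordinates in \<open>I\<close>, so nothing is lost by restricting to them.
\<close>
lemma sum_lipschitz_measurable:
  fixes H :: "('i::countable \<Rightarrow> 'a::{metric_space, second_countable_topology}) \<Rightarrow> real"
  assumes H: "\<And>x y. \<bar>H x - H y\<bar> \<le> (\<Sum>i\<in>I. dist (x i) (y i))"
    and sets: "sets \<mu> = sets borel"
  shows "H \<in> borel_measurable (PiM I (\<lambda>_. \<mu>))"
proof -
  have "continuous_on UNIV H"
    unfolding continuous_on
  proof
    fix x :: "'i \<Rightarrow> 'a"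
    have "((\<lambda>y. dist (y i) (x i)) \<longlongrightarrow> dist (x i) (x i)) (at x)" for i
      using continuous_on_product_coordinates[of i, unfolded continuous_on]
      by (intro tendsto_dist tendsto_const) auto
    then have "((\<lambda>y. \<Sum>i\<in>I. dist (y i) (x i)) \<longlongrightarrow> (\<Sum>i\<in>I. 0)) (at x)"
      by (intro tendsto_sum) auto
    then have "((\<lambda>y. \<Sum>i\<in>I. dist (y i) (x i)) \<longlongrightarrow> 0) (at x)" by simp
    then show "(H \<longlongrightarrow> H x) (at x within UNIV)"
      by (rule tendsto_dist_iff[THEN iffD2, OF tendsto_0_le[where K=1]]) (use H in \<open>auto simp: dist_real_def sum_nonneg intro!: always_eventually\<close>)
  qed
  then have "H \<in> borel_measurable borel"
    by (rule borel_measurable_continuous_onI)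
  then have 1: "H \<in> borel_measurable (PiM UNIV (\<lambda>_. borel))"
    using measurable_cong_sets[OF sets_PiM_equal_borel refl] by blast
  have 2: "(\<lambda>x. restrict x I) \<in> measurable (PiM I (\<lambda>_. borel)) (PiM UNIV (\<lambda>_. borel))"
  proof (rule measurable_PiM_single')
    show "(\<lambda>x. restrict x I i) \<in> measurable (PiM I (\<lambda>_. borel)) borel" for i
      by (cases "i \<in> I") auto
  qed auto
  have "H x = H (restrict x I)" for x
    using H[of x "restrict x I"] by simp
  then have "H \<circ> (\<lambda>x. restrict x I) = H" by (simp add: fun_eq_iff)
  with measurable_comp[OF 2 1] have "H \<in> borel_measurable (PiM I (\<lambda>_. borel))"
    by (simp only:)
  then show ?thesis
    using measurable_cong_sets[OF sets_PiM_cong[OF refl] refl, of I "\<lambda>_. \<mu>" "\<lambda>_. borel"] sets by blast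
qed

lemma sum_lipschitz_integrable:
  fixes H :: "('i::countable \<Rightarrow> 'a::{metric_space, second_countable_topology}) \<Rightarrow> real"
  assumes H: "\<And>x y. \<bar>H x - H y\<bar> \<le> (\<Sum>i\<in>I. dist (x i) (y i))"
    and \<mu>: "\<mu> \<in> borel_probs" and moment: "(\<integral>\<^sup>+x. ennreal (dist c x) \<partial>\<mu>) < \<infinity>"
  shows "integrable (PiM I (\<lambda>_. \<mu>)) H"
proof -
  interpret prob_space \<mu> using \<mu> by (rule borel_probsD)
  interpret P: prob_space "PiM I (\<lambda>_. \<mu>)"
    by (rule prob_space_PiM) (rule prob_space_axioms)
  have dist: "integrable \<mu> (\<lambda>x. dist c x)"
    using \<mu> moment dist_lipschitz by (rule lipschitz_integrable)
  have "integrable (PiM I (\<lambda>_. \<mu>)) (\<lambda>x. dist c (x i))" if "i \<in> I" for i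
  proof (rule integrable_distr[where f="\<lambda>x. dist c x"])
    show "(\<lambda>x. x i) \<in> measurable (PiM I (\<lambda>_. \<mu>)) \<mu>"
      using that by simp
    show "integrable (distr (PiM I (\<lambda>_. \<mu>)) \<mu> (\<lambda>x. x i)) (\<lambda>x. dist c x)"
      using dist that prob_space_axioms by (subst distr_PiM_component) auto
  qed
  then have "integrable (PiM I (\<lambda>_. \<mu>)) (\<lambda>x. \<bar>H (\<lambda>_. c)\<bar> + (\<Sum>i\<in>I. dist c (x i)))"
    by (intro Bochner_Integration.integrable_add Bochner_Integration.integrable_sum) auto
  then show ?thesis
  proof (rule Bochner_Integration.integrable_bound)
    show "H \<in> borel_measurable (PiM I (\<lambda>_. \<mu>))"
      using H borel_probsD(2)[OF \<mu>] by (rule sum_lipschitz_measurable)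
    have "\<bar>H x\<bar> \<le> \<bar>H (\<lambda>_. c)\<bar> + (\<Sum>i\<in>I. dist c (x i))" for x
      using H[of "\<lambda>_. c" x] by auto
    then show "AE x in PiM I (\<lambda>_. \<mu>). norm (H x) \<le> norm (\<bar>H (\<lambda>_. c)\<bar> + (\<Sum>i\<in>I. dist c (x i)))"
      by (auto intro!: order_trans[OF _ abs_ge_self])
  qed
qed

text \<open>
  Induction on the number of coordinates: with the others frozen, \<open>lap\<close> applies to the new
  coordinate and replaces \<open>H\<close> by its average \<open>K\<close> over that coordinate, at the cost of the factor
  \<open>exp A\<close>. Averaging preserves the Lipschitz hypothesis, so the induction hypothesis applies
  to \<open>K\<close>.
\<close>
lemma laplace_tensorize:
  fixes H :: "('i::countable \<Rightarrow> 'a::{metric_space, second_countable_topology}) \<Rightarrow> real"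
  assumes "finite I"
    and \<mu>: "\<mu> \<in> borel_probs" and moment: "(\<integral>\<^sup>+x. ennreal (dist c x) \<partial>\<mu>) < \<infinity>"
    and lap: "\<And>\<phi>. 1-lipschitz_on UNIV \<phi> \<Longrightarrow>
        (\<integral>\<^sup>+x. ennreal (exp (s * \<phi> x)) \<partial>\<mu>) \<le> ennreal (exp (s * (\<integral>x. \<phi> x \<partial>\<mu>) + A))"
    and H: "\<And>x y. \<bar>H x - H y\<bar> \<le> (\<Sum>i\<in>I. dist (x i) (y i))"
  shows "(\<integral>\<^sup>+x. ennreal (exp (s * H x)) \<partial>PiM I (\<lambda>_. \<mu>)) \<le>
           ennreal (exp (s * (\<integral>x. H x \<partial>PiM I (\<lambda>_. \<mu>)) + real (card I) * A))"
  using assms(1) H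
proof (induction I arbitrary: H rule: finite_induct)
  case empty
  interpret P: prob_space "PiM {} (\<lambda>_. \<mu>)"
    by (rule prob_space_PiM) auto
  have "H x = H undefined" for x
    using empty[of x undefined] by simp
  then have "H = (\<lambda>_. H undefined)" by (rule ext)
  then obtain h where "H = (\<lambda>_. h)" by blast
  then show ?case
    by (simp add: P.prob_space P.emeasure_space_1)
next
  case (insert i I)
  interpret prob_space \<mu> using \<mu> by (rule borel_probsD)
  interpret product_sigma_finite "\<lambda>_. \<mu>" ..
  have sets: "sets \<mu> = sets borel" using \<mu> by (rule borel_probsD)
  let ?P = "\<lambda>I. PiM I (\<lambda>_. \<mu>)"
  have H [measurable]: "H \<in> borel_measurable (?P (insert i I))"
    using insert.prems sets by (rule sum_lipschitz_measurable)
  have H_int: "integrable (?P (insert i I)) H"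
    using insert.prems \<mu> moment by (rule sum_lipschitz_integrable)
  have upd: "\<bar>H (x(i := a)) - H (y(i := b))\<bar> \<le> dist a b + (\<Sum>j\<in>I. dist (x j) (y j))" for x y a b
  proof -
    have "(\<Sum>j\<in>insert i I. dist ((x(i := a)) j) ((y(i := b)) j)) = dist a b + (\<Sum>j\<in>I. dist (x j) (y j))"
      using insert.hyps by (auto intro!: sum.cong)
    then show ?thesis using insert.prems[of "x(i := a)" "y(i := b)"] by (simp only:)
  qed
  have lip: "1-lipschitz_on UNIV (\<lambda>y. H (x(i := y)))" for x
    using upd[of x _ x] by (intro lipschitz_onI) (auto simp: dist_real_def)
  have int: "integrable \<mu> (\<lambda>y. H (x(i := y)))" for x
    using \<mu> moment lip by (rule lipschitz_integrable)
  define K where "K x = (\<integral>y. H (x(i := y)) \<partial>\<mu>)" for x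
  have K: "\<bar>K x - K y\<bar> \<le> (\<Sum>j\<in>I. dist (x j) (y j))" for x y
  proof -
    have "\<bar>K x - K y\<bar> = \<bar>\<integral>z. H (x(i := z)) - H (y(i := z)) \<partial>\<mu>\<bar>"
      using int by (simp add: K_def)
    also have "\<dots> \<le> (\<integral>z. (\<Sum>j\<in>I. dist (x j) (y j)) \<partial>\<mu>)"
    proof (intro integral_abs_bound[THEN order_trans] integral_mono)
      show "\<bar>H (x(i := z)) - H (y(i := z))\<bar> \<le> (\<Sum>j\<in>I. dist (x j) (y j))" for z
        using upd[of x z y z] by (simp only: dist_self add_0)
    qed (use int in auto)
    finally show ?thesis by (simp add: prob_space)
  qed
  have "(\<integral>\<^sup>+x. ennreal (exp (s * H x)) \<partial>?P (insert i I)) =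
      (\<integral>\<^sup>+x. (\<integral>\<^sup>+y. ennreal (exp (s * H (x(i := y)))) \<partial>\<mu>) \<partial>?P I)"
    using insert.hyps by (intro product_nn_integral_insert) auto
  also have "\<dots> \<le> (\<integral>\<^sup>+x. ennreal (exp A) * ennreal (exp (s * K x)) \<partial>?P I)"
    using lap[OF lip] by (intro nn_integral_mono) (simp add: K_def exp_add mult.commute flip: ennreal_mult)
  also have "\<dots> = ennreal (exp A) * (\<integral>\<^sup>+x. ennreal (exp (s * K x)) \<partial>?P I)"
    using sum_lipschitz_measurable[OF K sets] by (intro nn_integral_cmult) measurable
  also have "\<dots> \<le> ennreal (exp A) * ennreal (exp (s * (\<integral>x. K x \<partial>?P I) + real (card I) * A))"
    by (intro mult_left_mono insert.IH K) auto
  also have "(\<integral>x. K x \<partial>?P I) = (\<integral>x. H x \<partial>?P (insert i I))"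
    unfolding K_def using insert.hyps H_int by (intro product_integral_insert[symmetric])
  finally show ?case
    using insert.hyps by (simp add: algebra_simps flip: ennreal_mult exp_add)
qed

section \<open>The empirical process\<close>

text \<open>
  In the next two lemmas the sample is the identity map on sequences, so that the empirical process
  becomes a deterministic function of the sample points.
\<close>
lemma emp_process_sum_lipschitz:
  assumes lip: "\<And>\<phi>. \<phi> \<in> \<G> \<Longrightarrow> 1-lipschitz_on UNIV \<phi>"
  shows "emp_process \<mu> \<G> (\<lambda>i x. x i) n x \<le>
    emp_process \<mu> \<G> (\<lambda>i x. x i) n y + ennreal ((1 / real n) * (\<Sum>i=1..n. dist (x i) (y i)))"
  unfolding emp_process_def
proof (rule SUP_least)
  fix \<phi> assume \<phi>: "\<phi> \<in> \<G>"
  let ?D = "\<lambda>x. \<bar>(1 / real n) * (\<Sum>i=1..n. \<phi> (x i)) - (\<integral>x. \<phi> x \<partial>\<mu>)\<bar>"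
  have "\<bar>(\<Sum>i=1..n. \<phi> (x i)) - (\<Sum>i=1..n. \<phi> (y i))\<bar> \<le> (\<Sum>i=1..n. dist (x i) (y i))"
    using lipschitz_onD[OF lip[OF \<phi>]]
    by (auto simp: dist_real_def simp flip: sum_subtractf intro!: order_trans[OF sum_abs] sum_mono)
  then have "(1 / real n) * \<bar>(\<Sum>i=1..n. \<phi> (x i)) - (\<Sum>i=1..n. \<phi> (y i))\<bar> \<le> (1 / real n) * (\<Sum>i=1..n. dist (x i) (y i))"
    by (intro mult_left_mono) auto
  then have "\<bar>(1 / real n) * (\<Sum>i=1..n. \<phi> (x i)) - (1 / real n) * (\<Sum>i=1..n. \<phi> (y i))\<bar>
      \<le> (1 / real n) * (\<Sum>i=1..n. dist (x i) (y i))"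
    by (simp add: abs_mult flip: diff_divide_distrib right_diff_distrib)
  then have "?D x \<le> ?D y + (1 / real n) * (\<Sum>i=1..n. dist (x i) (y i))"
    by linarith
  then have "ennreal (?D x) \<le> ennreal (?D y + (1 / real n) * (\<Sum>i=1..n. dist (x i) (y i)))"
    by (rule ennreal_leI)
  also have "\<dots> = ennreal (?D y) + ennreal ((1 / real n) * (\<Sum>i=1..n. dist (x i) (y i)))"
    by (intro ennreal_plus mult_nonneg_nonneg sum_nonneg) auto
  also have "\<dots> \<le> (SUP \<phi>\<in>\<G>. ennreal \<bar>(1 / real n) * (\<Sum>i=1..n. \<phi> (y i)) - (\<integral>x. \<phi> x \<partial>\<mu>)\<bar>) +
      ennreal ((1 / real n) * (\<Sum>i=1..n. dist (x i) (y i)))"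
    by (intro add_right_mono SUP_upper \<phi>)
  finally show "ennreal (?D x) \<le> \<dots>" .
qed

text \<open>
  The supremum is finite even if the class is unbounded, because a 1-Lipschitz function differs from
  its mean at \<open>a\<close> by at most the mean distance to \<open>a\<close>.
\<close>
lemma emp_process_finite:
  fixes \<mu> :: "'a::{metric_space, second_countable_topology} measure"
  assumes \<mu>: "\<mu> \<in> borel_probs" and moment: "\<And>c. (\<integral>\<^sup>+x. ennreal (dist c x) \<partial>\<mu>) < \<infinity>"
    and lip: "\<And>\<phi>. \<phi> \<in> \<G> \<Longrightarrow> 1-lipschitz_on UNIV \<phi>" and n: "n \<ge> 1"
  shows "emp_process \<mu> \<G> (\<lambda>i x. x i) n x < \<infinity>"
proof -
  interpret prob_space \<mu> using \<mu> by (rule borel_probsD)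
  have dist: "integrable \<mu> (\<lambda>x. dist c x)" for c
    using \<mu> moment dist_lipschitz by (rule lipschitz_integrable)
  have "emp_process \<mu> \<G> (\<lambda>i x. x i) n x \<le> ennreal ((1 / real n) * (\<Sum>i=1..n. \<integral>y. dist (x i) y \<partial>\<mu>))"
    unfolding emp_process_def
  proof (intro SUP_least ennreal_leI)
    fix \<phi> assume \<phi>: "\<phi> \<in> \<G>"
    have int: "integrable \<mu> \<phi>" by (rule lipschitz_integrable[OF \<mu> moment lip[OF \<phi>]])
    have *: "\<bar>\<phi> a - (\<integral>y. \<phi> y \<partial>\<mu>)\<bar> \<le> (\<integral>y. dist a y \<partial>\<mu>)" for a
    proof -
      have "\<bar>\<phi> a - (\<integral>y. \<phi> y \<partial>\<mu>)\<bar> = \<bar>\<integral>y. \<phi> a - \<phi> y \<partial>\<mu>\<bar>"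
        using int by (simp add: prob_space)
      also have "\<dots> \<le> (\<integral>y. dist a y \<partial>\<mu>)"
        using int dist lipschitz_onD[OF lip[OF \<phi>], of a]
        by (intro integral_abs_bound[THEN order_trans] integral_mono) (auto simp: dist_real_def)
      finally show ?thesis .
    qed
    have "(1 / real n) * (\<Sum>i=1..n. \<phi> (x i)) - (\<integral>y. \<phi> y \<partial>\<mu>)
        = (1 / real n) * (\<Sum>i=1..n. \<phi> (x i) - (\<integral>y. \<phi> y \<partial>\<mu>))"
      using n by (simp add: sum_subtractf field_simps)
    then have "\<bar>(1 / real n) * (\<Sum>i=1..n. \<phi> (x i)) - (\<integral>y. \<phi> y \<partial>\<mu>)\<bar>
        = (1 / real n) * \<bar>\<Sum>i=1..n. \<phi> (x i) - (\<integral>y. \<phi> y \<partial>\<mu>)\<bar>"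
      by (simp add: abs_mult)
    also have "\<dots> \<le> (1 / real n) * (\<Sum>i=1..n. \<integral>y. dist (x i) y \<partial>\<mu>)"
      using * by (intro mult_left_mono order_trans[OF sum_abs] sum_mono) auto
    finally show "\<bar>(1 / real n) * (\<Sum>i=1..n. \<phi> (x i)) - (\<integral>y. \<phi> y \<partial>\<mu>)\<bar>
        \<le> (1 / real n) * (\<Sum>i=1..n. \<integral>y. dist (x i) y \<partial>\<mu>)" .
  qed
  also have "\<dots> < \<infinity>" by simp
  finally show ?thesis .
qed

section \<open>The deviation inequality\<close>

text \<open>
  This lets the supremum over lines be taken in the exponent. If \<open>p\<close> exceeded the claimed
  bound, it would equal \<open>exp (- n * r)\<close> with \<open>r < a\<close>, and any exponent strictly between
  \<open>r\<close> and \<open>a\<close> would contradict the hypothesis. This covers \<open>a = \<infinity>\<close> as well.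
\<close>
lemma le_exp_minusI:
  assumes n: "n \<ge> 1" and p: "p \<le> 1"
    and bound: "\<And>r. r > 0 \<Longrightarrow> ennreal r < a \<Longrightarrow> p \<le> exp (- (real n * r))"
  shows "p \<le> exp_minus (of_nat n * a)"
proof (rule ccontr)
  assume less: "\<not> p \<le> exp_minus (of_nat n * a)"
  have "0 \<le> exp_minus (of_nat n * a)" by (simp add: exp_minus_def)
  then have "p > 0" using less by linarith
  define r where "r = - ln p / real n"
  have r: "r \<ge> 0" "exp (- (real n * r)) = p"
    using n p \<open>p > 0\<close> by (auto simp: r_def intro: divide_nonpos_nonneg)
  have "ennreal r < a"
  proof (rule ccontr)
    assume "\<not> ennreal r < a"
    then have "a \<le> ennreal r" by simp
    then obtain b where b: "a = ennreal b" "0 \<le> b" "b \<le> r"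
      using r(1) by (cases a) (auto simp: top_unique)
    then have "of_nat n * a = ennreal (real n * b)"
      by (simp add: ennreal_mult flip: ennreal_of_nat_eq_real_of_nat)
    then have "exp_minus (of_nat n * a) = exp (- (real n * b))"
      using b by (simp add: exp_minus_def)
    also have "\<dots> \<ge> exp (- (real n * r))"
      using b by (simp add: mult_left_mono)
    finally show False using less r by simp
  qed
  then obtain r' where "ennreal r < r'" "r' < a" using dense by blast
  then obtain q where "r < q" "ennreal q < a"
    using r(1) by (cases r') (auto simp: ennreal_less_iff)
  then have "p \<le> exp (- (real n * q))" using r(1) by (intro bound) auto
  also have "\<dots> < exp (- (real n * r))" using n \<open>r < q\<close> by simp
  finally show False using r by simp
qed

theorem theorem6p10:
  fixes \<mu> :: "'a::{metric_space, second_countable_topology} measure"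
    and \<alpha> :: "real \<Rightarrow> ennreal"
    and M :: "'w measure"
    and X :: "nat \<Rightarrow> 'w \<Rightarrow> 'a"
    and \<G> :: "('a \<Rightarrow> real) set"
  assumes "completely_metrizable_space (euclidean :: 'a topology)"
    and "\<mu> \<in> borel_probs"
    and "\<And>x\<^sub>o. (\<integral>\<^sup>+x. ennreal (dist x\<^sub>o x) \<partial>\<mu>) < \<infinity>"
    and "\<alpha> \<in> alpha_class"
    and "\<And>\<nu>. \<nu> \<in> borel_probs \<Longrightarrow>
           enn2ereal (alpha_ext \<alpha> (transport_cost \<mu> \<nu>)) \<le> rel_entropy \<nu> \<mu>"
    and "prob_space M"
    and "prob_space.indep_vars M (\<lambda>_. borel) X {1..}"
    and "\<And>i. i \<ge> 1 \<Longrightarrow> distr M borel (X i) = \<mu>"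
    and "\<And>\<phi>. \<phi> \<in> \<G> \<Longrightarrow> 1-lipschitz_on UNIV \<phi>"
  shows "\<forall>n\<ge>1. \<forall>t\<ge>0.
           measure M {\<omega> \<in> space M. emp_process \<mu> \<G> X n \<omega> \<ge>
                        (\<integral>\<^sup>+\<omega>'. emp_process \<mu> \<G> X n \<omega>' \<partial>M) + ennreal t}
             \<le> exp_minus (of_nat n * \<alpha> t)"
proof (intro allI impI)
  fix n :: nat and t :: real
  assume n: "n \<ge> 1" and t: "t \<ge> 0"
  interpret prob_space M by fact
  note \<mu> = assms(2) and moment = assms(3) and \<alpha> = assms(4) and tci = assms(5) and lip = assms(9)
  let ?I = "{1..n}"
  define P where "P = PiM ?I (\<lambda>_. \<mu>)"
  define Y where "Y \<omega> = (\<lambda>i\<in>?I. X i \<omega>)" for \<omega>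
  define Z where "Z x = emp_process \<mu> \<G> (\<lambda>i x. x i) n x" for x
  define H where "H x = real n * enn2real (Z x)" for x

  \<comment> \<open>Independence transfers the problem to the product measure, which is where the exponential
    moment bound lives.\<close>
  have rv: "X i \<in> borel_measurable M" if "i \<in> ?I" for i
    using assms(7) that by (auto simp: indep_vars_def)
  have "indep_vars (\<lambda>_. borel) X ?I"
    using assms(7) by (rule indep_vars_subset) auto
  then have "distr M (PiM ?I (\<lambda>_. borel)) Y = PiM ?I (\<lambda>i. distr M borel (X i))"
    using indep_vars_iff_distr_eq_PiM'[of ?I X "\<lambda>_. borel"] rv n unfolding Y_def by auto
  also have "\<dots> = P"
    unfolding P_def using assms(8) by (intro PiM_cong) auto
  finally have distr: "distr M (PiM ?I (\<lambda>_. borel)) Y = P" .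
  have sets_P: "sets P = sets (PiM ?I (\<lambda>_. borel))"
    unfolding P_def using borel_probsD(2)[OF \<mu>] by (intro sets_PiM_cong) auto
  have Y [measurable]: "Y \<in> measurable M P"
    unfolding measurable_cong_sets[OF refl sets_P] Y_def using rv by (intro measurable_restrict) auto
  have distr': "distr M P Y = P"
    using distr distr_cong[OF refl sets_P, of M Y Y] by simp

  have Z_fin: "Z x < \<infinity>" for x
    unfolding Z_def by (rule emp_process_finite[OF \<mu> moment lip n])
  have Z_eq: "Z x = ennreal (H x / real n)" for x
    using Z_fin[of x] n by (simp add: H_def)
  have H_nonneg: "H x \<ge> 0" for x
    by (simp add: H_def)
  have H_le: "H x \<le> H y + (\<Sum>i\<in>?I. dist (x i) (y i))" for x y
  proof -
    have "Z x \<le> Z y + ennreal ((1 / real n) * (\<Sum>i\<in>?I. dist (x i) (y i)))"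
      unfolding Z_def by (rule emp_process_sum_lipschitz[OF lip])
    also have "\<dots> = ennreal (H y / real n + (1 / real n) * (\<Sum>i\<in>?I. dist (x i) (y i)))"
      unfolding Z_eq by (subst ennreal_plus) (auto simp: H_def sum_nonneg)
    finally have "H x / real n \<le> H y / real n + (1 / real n) * (\<Sum>i\<in>?I. dist (x i) (y i))"
      unfolding Z_eq by (subst (asm) ennreal_le_iff) (auto simp: H_def sum_nonneg)
    then show ?thesis using n by (simp add: field_simps)
  qed
  have H: "\<bar>H x - H y\<bar> \<le> (\<Sum>i\<in>?I. dist (x i) (y i))" for x y
    using H_le[of x y] H_le[of y x] by (auto simp: abs_le_iff dist_commute)
  have H_meas [measurable]: "H \<in> borel_measurable P"
    unfolding P_def using H borel_probsD(2)[OF \<mu>] by (rule sum_lipschitz_measurable)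
  have H_int: "integrable P H"
    unfolding P_def using H \<mu> moment by (rule sum_lipschitz_integrable)
  define m where "m = (\<integral>x. H x \<partial>P)"

  have emp: "emp_process \<mu> \<G> X n \<omega> = ennreal (H (Y \<omega>) / real n)" for \<omega>
    unfolding Z_eq[symmetric] Z_def emp_process_def by (simp add: Y_def)
  have "(\<integral>\<^sup>+\<omega>. emp_process \<mu> \<G> X n \<omega> \<partial>M) = (\<integral>\<^sup>+x. ennreal (H x / real n) \<partial>P)"
    unfolding emp using nn_integral_distr[OF Y, of "\<lambda>x. ennreal (H x / real n)"] distr' by simp
  also have "\<dots> = ennreal (m / real n)"
    using H_int H_nonneg unfolding m_def by (subst nn_integral_eq_integral) auto
  finally have mean: "(\<integral>\<^sup>+\<omega>. emp_process \<mu> \<G> X n \<omega> \<partial>M) = ennreal (m / real n)" .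
  have m: "m \<ge> 0" unfolding m_def by (simp add: H_nonneg)
  have "emp_process \<mu> \<G> X n \<omega> \<ge> ennreal (m / real n) + ennreal t \<longleftrightarrow> H (Y \<omega>) \<ge> m + real n * t" for \<omega>
    unfolding emp using m t n by (subst ennreal_plus[symmetric]) (auto simp: ennreal_le_iff H_def field_simps)
  then have "measure M {\<omega> \<in> space M. emp_process \<mu> \<G> X n \<omega> \<ge>
      (\<integral>\<^sup>+\<omega>'. emp_process \<mu> \<G> X n \<omega>' \<partial>M) + ennreal t} = measure M (Y -` {x \<in> space P. H x \<ge> m + real n * t} \<inter> space M)"
    unfolding mean using measurable_space[OF Y] by (intro arg_cong[where f="measure M"]) auto
  also have "\<dots> = measure P {x \<in> space P. H x \<ge> m + real n * t}"
    using measure_distr[OF Y, of "{x \<in> space P. H x \<ge> m + real n * t}"] distr' by simp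
  also have "\<dots> \<le> exp_minus (of_nat n * \<alpha> t)"
  proof (rule le_exp_minusI[OF n])
    interpret P: prob_space P
      using prob_space_distr[OF Y] unfolding distr' .
    show "measure P {x \<in> space P. H x \<ge> m + real n * t} \<le> 1" by auto
    fix r assume r: "r > 0" "ennreal r < \<alpha> t"
    have "\<alpha> 0 = 0" using \<alpha> by (simp add: alpha_class_def)
    then have "t > 0" using r t by (cases "t = 0") auto
    then obtain s A where sA: "s \<ge> 0" "A \<ge> 0" "\<And>u. u \<ge> 0 \<Longrightarrow> ennreal (s * u - A) \<le> \<alpha> u" "s * t - A \<ge> r"
      using alpha_supporting_line[OF \<alpha> _ _ r(2)] r(1) by (metis less_imp_le)
    \<comment> \<open>The Chernoff bound needs a positive slope; a flat line below \<open>\<alpha>\<close> cannot reach \<open>r > 0\<close>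
      because \<open>\<alpha> 0 = 0\<close>.\<close>
    have "s > 0" using sA r by (cases "s = 0") auto
    have lap: "(\<integral>\<^sup>+x. ennreal (exp (s * \<phi> x)) \<partial>\<mu>) \<le> ennreal (exp (s * (\<integral>x. \<phi> x \<partial>\<mu>) + A))"
      if "1-lipschitz_on UNIV \<phi>" for \<phi>
      by (rule laplace_lipschitz[OF \<mu> moment \<alpha> tci sA(1,3,2) that])
    have lapP: "(\<integral>\<^sup>+x. ennreal (exp (s * H x)) \<partial>P) \<le> ennreal (exp (s * m + real n * A))"
      using laplace_tensorize[OF _ \<mu> moment lap H] unfolding P_def m_def by simp
    have "emeasure P {x \<in> space P. H x \<ge> m + real n * t} \<le>
        ennreal (exp (- s * (m + real n * t))) * (\<integral>\<^sup>+x. ennreal (exp (s * H x)) * indicator (space P) x \<partial>P)"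
      using \<open>s > 0\<close> by (intro Chernoff_ineq_nn_integral_ge) auto
    also have "(\<integral>\<^sup>+x. ennreal (exp (s * H x)) * indicator (space P) x \<partial>P) = (\<integral>\<^sup>+x. ennreal (exp (s * H x)) \<partial>P)"
      by (intro nn_integral_cong) auto
    also have "ennreal (exp (- s * (m + real n * t))) * \<dots> \<le>
        ennreal (exp (- s * (m + real n * t))) * ennreal (exp (s * m + real n * A))"
      by (intro mult_left_mono lapP) auto
    also have "\<dots> = ennreal (exp (- (real n * (s * t - A))))"
      by (simp add: algebra_simps flip: ennreal_mult exp_add)
    also have "\<dots> \<le> ennreal (exp (- (real n * r)))"
      using sA(4) by (intro ennreal_leI) (auto intro!: mult_left_mono)
    finally show "measure P {x \<in> space P. H x \<ge> m + real n * t} \<le> exp (- (real n * r))"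
      by (simp add: P.emeasure_eq_measure)
  qed
  finally show "measure M {\<omega> \<in> space M. emp_process \<mu> \<G> X n \<omega> \<ge>
      (\<integral>\<^sup>+\<omega>'. emp_process \<mu> \<G> X n \<omega>' \<partial>M) + ennreal t} \<le> exp_minus (of_nat n * \<alpha> t)" .
qed

end
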